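(* Let $m\neq n$ be positive integers and let $x$ be a nonzero real number with $\Phi_m(x)=\Phi_n(x)$. Then $\frac12<|x|<2$, except in the case $x=2$ and $\{m,n\}=\{2,6\}$ (where indeed $\Phi_2(2)=\Phi_6(2)$).
   Context: For a positive integer $n$, $\Phi_n$ denotes the $n$-th cyclotomic polynomial, $\Phi_n(x)=\prod_{1\le a\le n,\ \gcd(a,n)=1}(x-\zeta_n^a)$, where $\zeta_n$ is a primitive $n$-th root of unity (so $\Phi_1(x)=x-1$). *)

theory Defs
  imports "HOL-Analysis.Analysis" "HOL-Computational_Algebra.Polynomial"
begin

text \<open>
  The primitive \<open>n\<close>-th root of unity is fixed as \<open>exp (2 \<pi> i / n)\<close>; the product does not depend
  on this choice.
\<close>
definition cyclotomic :: "nat \<Rightarrow> complex poly" where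
  "cyclotomic n = (\<Prod>a | 1 \<le> a \<and> a \<le> n \<and> coprime a n. [:- (cis (2 * pi / real n) ^ a), 1:])"

end

(*
For \<bar>y\<bar> < 1 put psi n y = (\<Prod>d | d dvd n. (1 - y^d)^moebius(n/d)). Moebius inversion gives
Phi_n(x) = x^totient(n) * psi n (1/x) for \<bar>x\<bar> > 1 and Phi_n(x) = psi n x (up to sign if n = 1) for
\<bar>x\<bar> < 1; replacing x by -x only permutes the indices, so it suffices to take 0 < y \<le> 1/2.
The numbers L k = - ln (1 - y^k) then satisfy 2 * L (k+1) < L k, so a sum of the L k with coefficients
in {-1, 0, 1} is governed by its first nonzero term. Up to a global sign, ln (psi n y) is such a sum
with first term L (n / radical n). Comparing these sums shows that psi n y determines n, and that
1 - y < psi n y \<le> 1 / (1 - y) for n > 1. Hence, for x \<ge> 2, Phi_n(x) is increasing in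
totient n and injective where totient is constant; the exception comes from totient values 1 and 2.
*)
theory Submission
  imports Defs
    "HOL-Computational_Algebra.Squarefree"
    "HOL-Computational_Algebra.Fundamental_Theorem_Algebra"
    "HOL-Number_Theory.Totient"
begin

section \<open>The Moebius function and the core\<close>

definition moebius :: "nat \<Rightarrow> real" where
  "moebius n = (if squarefree n then (-1) ^ card (prime_factors n) else 0)"

definition radical :: "nat \<Rightarrow> nat" where
  "radical n = \<Prod>(prime_factors n)"

lemma moebius_1 [simp]: "moebius 1 = 1"
  by (simp add: moebius_def)

lemma moebius_Suc_0 [simp]: "moebius (Suc 0) = 1"
  using moebius_1 by simp

lemma moebius_prime: "prime p \<Longrightarrow> moebius p = -1"
  by (simp add: moebius_def squarefree_prime prime_prime_factors)

lemma moebius_not_squarefree: "\<not> squarefree n \<Longrightarrow> moebius n = 0"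
  by (simp add: moebius_def)

lemma moebius_cases: "moebius n \<in> {-1, 0, 1}"
  using neg_one_even_power[where ?'a = real] neg_one_odd_power[where ?'a = real]
  by (cases "even (card (prime_factors n))") (auto simp: moebius_def)

lemma moebius_squarefree: "squarefree n \<Longrightarrow> moebius n = 1 \<or> moebius n = -1"
  using moebius_cases[of n] by (auto simp: moebius_def)

lemma moebius_mult_coprime:
  assumes "coprime a b"
  shows "moebius (a * b) = moebius a * moebius b"
proof (cases "squarefree (a * b)")
  case True
  then have sq: "squarefree a" "squarefree b"
    by (auto dest: squarefree_multD)
  then have nz: "a \<noteq> 0" "b \<noteq> 0" by (auto intro: Nat.gr0I)
  have "prime_factors a \<inter> prime_factors b = {}"
    using assms coprime_common_divisor[of a b] not_prime_unit
    by (metis disjoint_iff in_prime_factors_iff)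
  with nz have "card (prime_factors (a * b)) = card (prime_factors a) + card (prime_factors b)"
    by (simp add: prime_factors_product card_Un_disjoint)
  with True sq show ?thesis
    by (simp add: moebius_def power_add)
next
  case False
  then have "\<not> squarefree a \<or> \<not> squarefree b"
    using squarefree_mult_coprime[OF assms] by auto
  with False show ?thesis by (auto simp: moebius_def)
qed

lemma squarefree_mult_imp_coprime:
  assumes "squarefree (a * b :: nat)"
  shows "coprime a b"
proof (rule ccontr)
  assume "\<not> coprime a b"
  then obtain d where d: "d dvd a" "d dvd b" "\<not> is_unit d"
    by (auto simp: coprime_def)
  then have "d ^ 2 dvd a * b" by (simp add: power2_eq_square mult_dvd_mono)
  with assms d(3) show False by (auto dest: squarefreeD)
qed

lemma moebius_4: "moebius 4 = 0"
  by (rule moebius_not_squarefree, rule not_squarefreeI[of 2]) auto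

lemma moebius_6: "moebius 6 = 1"
  using moebius_mult_coprime[of 2 3] by (simp add: moebius_prime)

text \<open>Fix a prime p dividing n and let m be the part of n prime to p. A squarefree divisor of
  n contains p at most once, so only the numbers d and p * d with d dividing m contribute, and these
  cancel because \<open>moebius (p * d) = - moebius d\<close>.\<close>

lemma sum_moebius:
  fixes n :: nat
  assumes "n > 0"
  shows "(\<Sum>d | d dvd n. moebius d) = (if n = 1 then 1 else 0)"
proof (cases "n = 1")
  case True
  have "{d. d dvd (1::nat)} = {1}" by auto
  with True show ?thesis by simp
next
  case False
  then obtain p where p: "prime p" "p dvd n"
    using prime_factor_nat by blast
  define m where "m = n div p ^ multiplicity p n"
  define k where "k = multiplicity p n"
  have n: "n = p ^ k * m"
    unfolding m_def k_def by (simp add: multiplicity_dvd)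
  have k: "k > 0" unfolding k_def using p assms
    by (simp add: prime_multiplicity_gt_zero_iff)
  have pm: "\<not> p dvd m" unfolding m_def using multiplicity_decompose[of n p] assms p
    by (metis gr_implies_not0 not_prime_unit)
  have m0: "m > 0" using pm by (auto intro: Nat.gr0I)
  let ?D = "{d. d dvd m}"
  have fin: "finite ?D" using m0 by simp
  have dis: "?D \<inter> (*) p ` ?D = {}" using pm by (auto dest: dvd_mult_left)
  have inj: "inj_on ((*) p) ?D" using p by (auto simp: inj_on_def prime_gt_0_nat)
  have "(\<Sum>d | d dvd n. moebius d) = (\<Sum>d\<in>?D \<union> (*) p ` ?D. moebius d)"
  proof (rule sum.mono_neutral_right)
    show "finite {d. d dvd n}" using assms by simp
    have "p * d dvd n" if "d dvd m" for d
      unfolding n using that k by (intro mult_dvd_mono) (auto intro: dvd_power)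
    then show "?D \<union> (*) p ` ?D \<subseteq> {d. d dvd n}" using n by auto
    show "\<forall>d\<in>{d. d dvd n} - (?D \<union> (*) p ` ?D). moebius d = 0"
    proof
      fix d assume d: "d \<in> {d. d dvd n} - (?D \<union> (*) p ` ?D)"
      have "\<not> squarefree d"
      proof
        assume sf: "squarefree d"
        show False
        proof (cases "p dvd d")
          case False
          then have "coprime d (p ^ k)" using p
            by (metis coprime_commute coprime_power_right_iff prime_imp_coprime)
          with d n have "d dvd m" using coprime_dvd_mult_right_iff by blast
          with d show False by simp
        next
          case True
          then obtain e where e: "d = p * e" by blast
          with sf have "coprime p e" using squarefree_mult_imp_coprime by blast
          then have "coprime e (p ^ k)" by (simp add: coprime_commute)
          moreover have "e dvd p ^ k * m" using d e n by (auto dest: dvd_mult_right)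
          ultimately have "e dvd m" by (simp add: coprime_dvd_mult_right_iff)
          with d e show False by auto
        qed
      qed
      then show "moebius d = 0" by (rule moebius_not_squarefree)
    qed
  qed
  also have "\<dots> = (\<Sum>d\<in>?D. moebius d) + (\<Sum>d\<in>?D. moebius (p * d))"
    using fin dis inj by (simp add: sum.union_disjoint sum.reindex)
  also have "(\<Sum>d\<in>?D. moebius (p * d)) = (\<Sum>d\<in>?D. - moebius d)"
  proof (rule sum.cong)
    fix d assume "d \<in> ?D"
    then have "\<not> p dvd d" using pm by (auto dest: dvd_trans)
    then have "coprime p d" using p by (simp add: prime_imp_coprime)
    then show "moebius (p * d) = - moebius d" using p
      by (simp add: moebius_mult_coprime moebius_prime)
  qed auto
  finally show ?thesis using False by (simp add: sum_negf)
qed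

text \<open>After exchanging the sums, fix e and write d = e * b. The inner sum becomes the Moebius
  sum over the divisors b of n / e, which vanishes unless e = n.\<close>

lemma moebius_inversion:
  fixes h :: "nat \<Rightarrow> real"
  assumes "n > 0"
  shows "(\<Sum>d | d dvd n. \<Sum>e | e dvd d. moebius (d div e) * h e) = h n"
proof -
  have fin: "finite {d. d dvd n}" using assms by simp
  have "(\<Sum>d | d dvd n. \<Sum>e | e dvd d. moebius (d div e) * h e)
      = (\<Sum>d | d dvd n. \<Sum>e | e \<in> {e. e dvd n} \<and> e dvd d. moebius (d div e) * h e)"
    by (intro sum.cong) (auto intro: dvd_trans)
  also have "\<dots> = (\<Sum>e | e dvd n. \<Sum>d | d \<in> {d. d dvd n} \<and> e dvd d. moebius (d div e) * h e)"
    by (rule sum.swap_restrict) (use fin in auto)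
  also have "\<dots> = (\<Sum>e | e dvd n. if e = n then h n else 0)"
  proof (intro sum.cong refl)
    fix e assume "e \<in> {e. e dvd n}"
    then obtain c where c: "n = e * c" by auto
    with assms have pos: "e > 0" "c > 0" by auto
    have "(\<Sum>d | d \<in> {d. d dvd n} \<and> e dvd d. moebius (d div e) * h e)
        = (\<Sum>b | b dvd c. moebius b * h e)"
      using pos c
      by (intro sum.reindex_bij_witness[of _ "\<lambda>b. e * b" "\<lambda>d. d div e"]) auto
    also have "\<dots> = (if c = 1 then 1 else 0) * h e"
      by (simp only: sum_distrib_right[symmetric] sum_moebius[OF pos(2)])
    finally show "(\<Sum>d | d \<in> {d. d dvd n} \<and> e dvd d. moebius (d div e) * h e)
        = (if e = n then h n else 0)" using c pos by auto
  qed
  also have "\<dots> = h n" using fin by simp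
  finally show ?thesis .
qed

section \<open>Radical and core of an integer\<close>

lemma prime_dvd_radical_iff:
  assumes "prime p" "n > 0"
  shows "p dvd radical n \<longleftrightarrow> p dvd n"
proof -
  have "p dvd radical n \<longleftrightarrow> (\<exists>q\<in>prime_factors n. p dvd q)"
    unfolding radical_def using assms by (simp add: prime_dvd_prod_iff)
  also have "\<dots> \<longleftrightarrow> p dvd n"
    using assms by (auto simp: prime_factors_dvd primes_dvd_imp_eq)
  finally show ?thesis .
qed

lemma squarefree_radical: "squarefree (radical n)"
  unfolding radical_def
  by (rule squarefree_prod_coprime) (auto intro!: squarefree_prime primes_coprime)

lemma radical_pos: "radical n > 0"
  using squarefree_radical[of n] by (auto intro: Nat.gr0I)

text \<open>Squarefreeness caps every prime multiplicity of k at 1, and each prime divisor of n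
  occurs in the radical. Together with \<open>radical_dvd\<close> this makes the radical the largest
  squarefree divisor of n.\<close>

lemma squarefree_dvd_radical:
  assumes "squarefree k" "k dvd n" "n > 0"
  shows "k dvd radical n"
proof (rule multiplicity_le_imp_dvd)
  have k0: "k > 0" using assms by (auto intro: Nat.gr0I)
  then show "k \<noteq> 0" by simp
  fix p :: nat assume p: "prime p"
  show "multiplicity p k \<le> multiplicity p (radical n)"
  proof (cases "p dvd k")
    case True
    with p assms have "p dvd radical n" by (auto simp: prime_dvd_radical_iff intro: dvd_trans)
    then have "multiplicity p (radical n) \<ge> 1" using p radical_pos[of n]
      by (simp add: Suc_le_eq prime_multiplicity_gt_zero_iff)
    moreover have "multiplicity p k \<le> 1"
      using assms(1) k0 p by (simp add: squarefree_factorial_semiring'')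
    ultimately show ?thesis by simp
  next
    case False
    then show ?thesis by (simp add: not_dvd_imp_multiplicity_0)
  qed
qed

lemma radical_dvd:
  assumes "n > 0"
  shows "radical n dvd n"
proof (rule multiplicity_le_imp_dvd)
  show "radical n \<noteq> 0" using radical_pos[of n] by simp
  fix p :: nat assume p: "prime p"
  show "multiplicity p (radical n) \<le> multiplicity p n"
  proof (cases "p dvd n")
    case True
    then have "multiplicity p n \<ge> 1" using p assms
      by (simp add: Suc_le_eq prime_multiplicity_gt_zero_iff)
    moreover have "multiplicity p (radical n) \<le> 1"
      using squarefree_radical[of n] radical_pos[of n] p by (simp add: squarefree_factorial_semiring'')
    ultimately show ?thesis by simp
  next
    case False
    then have "\<not> p dvd radical n" using p assms by (simp add: prime_dvd_radical_iff)
    then show ?thesis by (simp add: not_dvd_imp_multiplicity_0)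
  qed
qed

text \<open>The least index occurring with a nonzero exponent in the product \<open>psi n\<close>.\<close>
definition core :: "nat \<Rightarrow> nat" where
  "core n = n div radical n"

lemma core_radical: "n > 0 \<Longrightarrow> core n * radical n = n"
  by (simp add: core_def radical_dvd)

lemma core_pos: "n > 0 \<Longrightarrow> core n > 0"
  using core_radical[of n] by (auto intro: Nat.gr0I)

text \<open>The exponents of \<open>psi n\<close>, normalised by the sign \<open>moebius (radical n)\<close> so that the first one is \<open>1\<close>.\<close>
definition core_coeff :: "nat \<Rightarrow> nat \<Rightarrow> real" where
  "core_coeff n j = (if core n dvd j \<and> j dvd n then moebius (j div core n) else 0)"

text \<open>The cofactor \<open>n div j\<close> is squarefree exactly when it divides
  \<open>radical n\<close>, that is, when \<open>core n\<close> divides j. Then j =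
  \<open>core n\<close> * e and \<open>radical n\<close> = e * f with f = \<open>n div j\<close>;
  multiplying \<open>moebius (radical n) = moebius e * moebius f\<close> by
  \<open>moebius e\<close>, a sign, isolates \<open>moebius f\<close>.\<close>

lemma moebius_cofactor:
  assumes "n > 0" "j dvd n"
  shows "moebius (n div j) = moebius (radical n) * core_coeff n j"
proof (cases "core n dvd j")
  case True
  then obtain e where e: "j = core n * e" by blast
  have "core n * e dvd core n * radical n" using assms e core_radical by simp
  then have "e dvd radical n" using core_pos[OF assms(1)] by simp
  then obtain f where f: "radical n = e * f" by blast
  have "n = j * f" using core_radical[OF assms(1)] e f by simp
  moreover have "j > 0" using assms by (auto intro: Nat.gr0I)
  ultimately have "n div j = f" by simp
  moreover have "moebius (radical n) = moebius e * moebius f"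
    using squarefree_radical[of n] f
    by (simp add: moebius_mult_coprime squarefree_mult_imp_coprime)
  moreover have "squarefree e" using squarefree_radical[of n] f by (auto dest: squarefree_multD)
  then have "moebius e * moebius e = 1" using moebius_squarefree[of e] by auto
  moreover have "core_coeff n j = moebius e"
    using assms e core_pos[OF assms(1)] by (simp add: core_coeff_def)
  ultimately show ?thesis by (simp add: mult.commute mult.left_commute)
next
  case False
  obtain k where k: "n = j * k" using assms by blast
  have j0: "j > 0" using assms by (auto intro: Nat.gr0I)
  have "\<not> squarefree k"
  proof
    assume "squarefree k"
    then have "k dvd radical n" using k assms by (intro squarefree_dvd_radical) auto
    then obtain l where l: "radical n = k * l" by blast
    have "j * k = core n * l * k" using core_radical[OF assms(1)] l k by (simp only: ac_simps)
    moreover have "k > 0" using k assms by (auto intro: Nat.gr0I)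
    ultimately have "j = core n * l" by simp
    with False show False by simp
  qed
  then show ?thesis using False k j0 by (simp add: core_coeff_def moebius_not_squarefree)
qed

lemma core_coeff_cases: "core_coeff n j \<in> {-1, 0, 1}"
  using moebius_cases by (simp add: core_coeff_def)

lemma abs_core_coeff_le: "\<bar>core_coeff n j\<bar> \<le> 1"
  using core_coeff_cases[of n j] by auto

lemma core_coeff_core: "n > 0 \<Longrightarrow> core_coeff n (core n) = 1"
  using core_radical[of n] core_pos[of n] by (auto simp: core_coeff_def) (metis dvd_triv_left)

lemma core_coeff_eq_0: "\<not> core n dvd j \<Longrightarrow> core_coeff n j = 0"
  by (simp add: core_coeff_def)

lemma core_coeff_self: "n > 0 \<Longrightarrow> core_coeff n n \<noteq> 0"
  using core_radical[of n] core_pos[of n] moebius_squarefree[OF squarefree_radical[of n]]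
  by (auto simp: core_coeff_def) (metis dvd_triv_left nonzero_mult_div_cancel_left not_gr0 one_neq_zero
    zero_neq_neg_one)+

section \<open>Signed sums of a halving sequence\<close>

lemma halving_tail_sum:
  fixes L :: "nat \<Rightarrow> real"
  assumes pos: "\<And>k. k > 0 \<Longrightarrow> L k > 0"
    and half: "\<And>k. k > 0 \<Longrightarrow> 2 * L (Suc k) < L k"
    and k: "k > 0" and c: "\<And>j. \<bar>c j\<bar> \<le> 1"
  shows "\<bar>\<Sum>j=Suc k..N. c j * L j\<bar> < L k"
proof (cases "k \<le> N")
  case True
  \<comment> \<open>The extra \<open>- L N\<close> makes the bound inductive: the next term costs at
    most \<open>L (Suc N)\<close>, and halving gives
    \<open>L (Suc N) - L N < - L (Suc N)\<close>.\<close>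
  have "\<bar>\<Sum>j=Suc k..N. c j * L j\<bar> \<le> L k - L N" using True
  proof (induction N rule: dec_induct)
    case (step N)
    have "\<bar>c (Suc N) * L (Suc N)\<bar> \<le> L (Suc N)"
      using c[of "Suc N"] pos[of "Suc N"] by (simp add: abs_mult mult_left_le_one_le)
    then show ?case using step half[of N] k by simp
  qed simp
  also have "\<dots> < L k" using pos[of N] k True by simp
  finally show ?thesis .
next
  case False
  with pos[OF k] show ?thesis by simp
qed

text \<open>The first nonzero term outweighs all later terms together.\<close>

lemma halving_signed_sum_neq_0:
  fixes L :: "nat \<Rightarrow> real"
  assumes pos: "\<And>k. k > 0 \<Longrightarrow> L k > 0"
    and half: "\<And>k. k > 0 \<Longrightarrow> 2 * L (Suc k) < L k"
    and c: "\<And>j. c j \<in> {-1, 0, 1}"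
    and i: "i \<in> {1..N}" "c i \<noteq> 0"
  shows "(\<Sum>j=1..N. c j * L j) \<noteq> 0"
proof -
  define k where "k = (LEAST k. k \<in> {1..N} \<and> c k \<noteq> 0)"
  have k: "k \<in> {1..N}" "c k \<noteq> 0" unfolding k_def
    using LeastI[of "\<lambda>k. k \<in> {1..N} \<and> c k \<noteq> 0" i] i by auto
  have less: "c j = 0" if "j \<in> {1..<k}" for j
    using not_less_Least[of j "\<lambda>k. k \<in> {1..N} \<and> c k \<noteq> 0"] that k unfolding k_def[symmetric]
    by auto
  have c': "\<And>j. \<bar>c j\<bar> \<le> 1" using c by (metis abs_0 abs_1 abs_minus_cancel insertE order_refl
    singletonD zero_le_one)
  have "(\<Sum>j=1..N. c j * L j) = (\<Sum>j\<in>{1..<k} \<union> {k..N}. c j * L j)"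
    using k by (intro sum.cong) auto
  also have "\<dots> = (\<Sum>j=k..N. c j * L j)"
    using less by (subst sum.union_disjoint) auto
  also have "\<dots> = c k * L k + (\<Sum>j=Suc k..N. c j * L j)"
    using k by (simp add: sum.atLeast_Suc_atMost)
  finally have eq: "(\<Sum>j=1..N. c j * L j) = c k * L k + (\<Sum>j=Suc k..N. c j * L j)" .
  have "\<bar>c k * L k\<bar> = L k" using c[of k] k pos[of k] by (auto simp: abs_mult)
  moreover have "\<bar>\<Sum>j=Suc k..N. c j * L j\<bar> < L k"
    using k by (intro halving_tail_sum pos half c') auto
  ultimately show ?thesis unfolding eq by linarith
qed

section \<open>The weights \<open>log_weight y k\<close>, written L k below\<close>

definition log_weight :: "real \<Rightarrow> nat \<Rightarrow> real" where
  "log_weight y k = - ln (1 - y ^ k)"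

lemma log_weight_pos:
  assumes "0 < y" "y < 1" "k > 0"
  shows "log_weight y k > 0"
proof -
  have "y ^ k < 1" "y ^ k > 0" using assms by (auto simp: power_less_one_iff)
  then show ?thesis by (simp add: log_weight_def)
qed

text \<open>Exponentiated, the claim is 1 - y^k < (1 - y^(k+1))^2. The bound y \<le> 1/2 enters as 2
  y^(k+1) \<le> y^k, and strictness comes from the square of y^(k+1).\<close>

lemma log_weight_half:
  assumes "0 < y" "y \<le> 1/2" "k > 0"
  shows "2 * log_weight y (Suc k) < log_weight y k"
proof -
  have k: "y ^ k < 1" "y ^ k > 0" using assms by (auto simp: power_less_one_iff)
  have sk: "y ^ Suc k < 1" "y ^ Suc k > 0" using assms by (auto simp: power_less_one_iff simp del: power_Suc)
  have "2 * y ^ Suc k \<le> y ^ k" using assms k by simp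
  then have "1 - y ^ k \<le> 1 - 2 * y ^ Suc k" by simp
  also have "\<dots> < (1 - y ^ Suc k)\<^sup>2" using sk assms(1) by (simp add: power2_diff del: power_Suc)
  finally have "ln (1 - y ^ k) < ln ((1 - y ^ Suc k)\<^sup>2)" using k by (subst ln_less_cancel_iff) auto
  also have "\<dots> = 2 * ln (1 - y ^ Suc k)" using sk by (simp add: ln_realpow del: power_Suc)
  finally show ?thesis by (simp add: log_weight_def del: power_Suc)
qed

section \<open>Core sums: bounds and injectivity in the index\<close>

definition core_sum :: "nat \<Rightarrow> real \<Rightarrow> real" where
  "core_sum n y = (\<Sum>j | j dvd n. core_coeff n j * log_weight y j)"

lemma core_sum_altdef:
  assumes "n > 0" "n \<le> N"
  shows "core_sum n y = (\<Sum>j=core n..N. core_coeff n j * log_weight y j)"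
  unfolding core_sum_def
proof (rule sum.mono_neutral_cong)
  have *: "core n \<le> j \<and> j \<le> N" if "j dvd n" "core n dvd j" for j
    using that assms by (metis dvd_imp_le dvd_pos_nat order_trans)
  show "\<And>i. i \<in> {core n..N} - {j. j dvd n} \<Longrightarrow> core_coeff n i * log_weight y i = 0"
    by (auto simp: core_coeff_def)
  show "\<And>i. i \<in> {j. j dvd n} - {core n..N} \<Longrightarrow> core_coeff n i * log_weight y i = 0"
    using * by (auto simp: core_coeff_def)
qed (use assms in auto)

text \<open>A summation range independent of the core and with a free upper limit allows sums for
  different n to be compared term by term.\<close>

lemma core_sum_from_1:
  assumes "n > 0" "n \<le> N"
  shows "core_sum n y = (\<Sum>j=1..N. core_coeff n j * log_weight y j)"
  unfolding core_sum_def
proof (rule sum.mono_neutral_cong)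
  show "\<And>i. i \<in> {j. j dvd n} - {1..N} \<Longrightarrow> core_coeff n i * log_weight y i = 0"
    using assms dvd_imp_le[of _ n] by (auto intro: Nat.gr0I) (metis dvd_0_left_iff le_trans not_less_eq_eq not_gr0)
qed (use assms in \<open>auto simp: core_coeff_def\<close>)

context
  fixes y :: real
  assumes y: "0 < y" "y \<le> 1/2"
begin

lemma log_weight_tail:
  "k > 0 \<Longrightarrow> \<bar>\<Sum>j=Suc k..N. core_coeff n j * log_weight y j\<bar> < log_weight y k"
  using y by (intro halving_tail_sum log_weight_pos log_weight_half abs_core_coeff_le) auto

lemma log_weight_antimono:
  assumes "0 < j" "j \<le> k"
  shows "log_weight y k \<le> log_weight y j"
  using assms(2)
proof (induction k rule: dec_induct)
  case (step k)
  then show ?case using log_weight_half[of y k] log_weight_pos[of y "Suc k"] y assms by simp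
qed auto

lemma core_sum_core:
  assumes "n > 0" "n \<le> N"
  shows "core_sum n y = log_weight y (core n) + (\<Sum>j=Suc (core n)..N. core_coeff n j * log_weight y j)"
proof -
  have "core n \<le> n" using core_radical[of n] radical_pos[of n] assms
    by (metis dvd_imp_le dvd_triv_left)
  then show ?thesis
    using assms by (simp add: core_sum_altdef[OF assms] sum.atLeast_Suc_atMost core_coeff_core)
qed

lemma core_sum_pos:
  assumes "n > 0"
  shows "core_sum n y > 0"
  using log_weight_tail[of "core n" n n] core_pos[OF assms] core_sum_core[OF assms order_refl] by linarith

text \<open>If p is the least prime factor of n, the first nonzero term after the leading one sits
  at \<open>core n\<close> * p and has coefficient -1. It outweighs everything beyond it, so the sum
  after the leading term is negative.\<close>

lemma core_sum_less_log_weight_core: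
  assumes "n > 1"
  shows "core_sum n y < log_weight y (core n)"
proof -
  let ?q = "core n"
  have q: "?q > 0" using core_pos assms by simp
  have fin: "n > 0" using assms by simp
  have "\<exists>p. prime p \<and> p dvd n" using prime_factor_nat[of n] assms by auto
  define p where "p = (LEAST p. prime p \<and> p dvd n)"
  have p: "prime p" "p dvd n" unfolding p_def using LeastI_ex[OF \<open>\<exists>p. prime p \<and> p dvd n\<close>] by auto
  have pmin: "p \<le> p'" if "prime p'" "p' dvd n" for p'
    unfolding p_def using that by (intro Least_le) auto
  have "p dvd radical n" using p fin by (simp add: prime_dvd_radical_iff)
  then have pq: "?q * p dvd n" using core_radical[OF fin] by (metis mult_dvd_mono dvd_refl)
  then have le: "?q * p \<le> n" using fin by (simp add: dvd_imp_le)
  have p2: "p \<ge> 2" using p prime_ge_2_nat by blast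
  have lt: "?q < ?q * p" using q p2 by simp
  have kp: "core_coeff n (?q * p) = -1" using pq q p by (simp add: core_coeff_def moebius_prime)
  \<comment> \<open>A nonzero coefficient here would give j = \<open>core n\<close> * e with 1 < e <
    p, and a prime factor of e would divide n although it is smaller than p.\<close>
  have zero: "core_coeff n j = 0" if "j \<in> {Suc ?q..<?q * p}" for j
  proof (rule ccontr)
    assume "core_coeff n j \<noteq> 0"
    then have "?q dvd j" "j dvd n" by (auto simp: core_coeff_def split: if_splits)
    then obtain e where e: "j = ?q * e" by blast
    with that q have "e < p" by auto
    have "\<not> e \<le> 1"
    proof
      assume "e \<le> 1"
      then have "?q * e \<le> ?q * 1" by (rule mult_le_mono2)
      with e that show False by simp
    qed
    then have "1 < e" by simp
    then obtain p' where p': "prime p'" "p' dvd e" using prime_factor_nat[of e] by auto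
    with e \<open>j dvd n\<close> have "p' dvd n" by (metis dvd_mult dvd_trans)
    with p' pmin have "p \<le> p'" by blast
    with p' \<open>e < p\<close> \<open>1 < e\<close> show False using dvd_imp_le[of p' e] by simp
  qed
  have "(\<Sum>j=Suc ?q..n. core_coeff n j * log_weight y j)
      = (\<Sum>j\<in>{Suc ?q..<?q*p} \<union> {?q*p..n}. core_coeff n j * log_weight y j)"
    using ivl_disj_un_two(3)[of "Suc ?q" "?q * p" "Suc n"] lt le
    by (simp add: Suc_le_eq atLeastLessThanSuc_atLeastAtMost)
  also have "\<dots> = (\<Sum>j=?q*p..n. core_coeff n j * log_weight y j)"
    using zero by (subst sum.union_disjoint) auto
  also have "\<dots> = - log_weight y (?q*p) + (\<Sum>j=Suc (?q*p)..n. core_coeff n j * log_weight y j)"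
    using le by (simp add: sum.atLeast_Suc_atMost kp)
  also have "\<dots> < 0" using log_weight_tail[of "?q*p" n n] q p2 by auto
  finally show ?thesis using core_sum_core[OF fin order_refl] by simp
qed

lemma core_sum_le_log_weight_core: "n > 0 \<Longrightarrow> core_sum n y \<le> log_weight y (core n)"
proof (cases "n = 1")
  case True
  have "{j. j dvd (1::nat)} = {1}" by auto
  then show ?thesis using True core_coeff_core[of 1]
    by (simp add: core_sum_def core_def radical_def)
qed (use core_sum_less_log_weight_core[of n] in auto)

lemma core_sum_less_log_weight_1:
  assumes "n > 1"
  shows "core_sum n y < log_weight y 1"
  using core_sum_less_log_weight_core[OF assms] log_weight_antimono[of 1 "core n"] core_pos[of n] assms by auto

lemma power_bounds: "0 < y ^ k" "y ^ k \<le> (1/2) ^ k"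
  using y by (auto intro: power_mono)

text \<open>The next three inequalities settle the cases where the two cores are \<open>1\<close> and \<open>2\<close> or \<open>3\<close>:
  there the factor \<open>1/2\<close> between consecutive weights does not suffice.\<close>
lemma log_weight_ineq_3: "log_weight y 2 + 2 * log_weight y 3 + log_weight y 4 < log_weight y 1"
proof -
  have s: "y^2 < 1" "y^3 < 1" "y^4 < 1" "y < 1" using y by (auto simp: power_less_one_iff)
  \<comment> \<open>Exponentiated, the claim is 1 - y < (1 - y^2) (1 - y^3)^2 (1 - y^4); cancelling
    1 - y and bounding the last two factors below leads to this polynomial. Its bracket is smallest
    at y = 1/2, with value 1/16.\<close>
  have "0 < y * (1 - 2 * y^2 - 3 * y^3 - y^4)"
    using y power_bounds(2)[of 2] power_bounds(2)[of 3] power_bounds(2)[of 4]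
    by (intro mult_pos_pos) (simp_all add: power_divide)
  also have "\<dots> = (1 + y) * (1 - 2 * y^3 - y^4) - (1)" by algebra
  finally have "1 < (1 + y) * (1 - 2 * y^3 - y^4)" by simp
  also have "1 - 2 * y^3 - y^4 \<le> (1 - y^3)^2 * (1 - y^4)"
  proof -
    have "0 \<le> (y^3)^2 * (1 - y^4) + 2 * y^3 * y^4" using s y by simp
    also have "\<dots> = (1 - y^3)^2 * (1 - y^4) - (1 - 2 * y^3 - y^4)" by algebra
    finally show ?thesis by simp
  qed
  finally have "(1 - y) * 1 < (1 - y) * ((1 + y) * ((1 - y^3)^2 * (1 - y^4)))"
    using y by simp
  also have "\<dots> = (1 - y^2) * (1 - y^3)^2 * (1 - y^4)" by algebra
  finally have "ln (1 - y) < ln ((1 - y^2) * (1 - y^3)^2 * (1 - y^4))"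
    using s by (subst ln_less_cancel_iff) auto
  then show ?thesis using s by (simp add: log_weight_def ln_mult ln_realpow)
qed

lemma log_weight_ineq_2: "2 * log_weight y 2 + log_weight y 4 < log_weight y 1"
proof -
  have s: "y^2 < 1" "y^4 < 1" "y < 1" using y by (auto simp: power_less_one_iff)
  \<comment> \<open>The same reduction; the bracket is again at least 1/16.\<close>
  have "0 < y * (1 - y - y^2 - y^3 - y^4)"
    using y power_bounds(2)[of 2] power_bounds(2)[of 3] power_bounds(2)[of 4]
    by (intro mult_pos_pos) (simp_all add: power_divide)
  also have "\<dots> = (1 + y) * (1 - y^2 - y^4) - (1)" by algebra
  finally have "1 < (1 + y) * (1 - y^2 - y^4)" by simp
  also have "1 - y^2 - y^4 \<le> (1 - y^2) * (1 - y^4)" using y by (simp add: algebra_simps)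
  finally have "(1 - y) * 1 < (1 - y) * ((1 + y) * ((1 - y^2) * (1 - y^4)))"
    using y by simp
  also have "\<dots> = (1 - y^2)^2 * (1 - y^4)" by algebra
  finally have "ln (1 - y) < ln ((1 - y^2)^2 * (1 - y^4))"
    using s by (subst ln_less_cancel_iff) auto
  then show ?thesis using s by (simp add: log_weight_def ln_mult ln_realpow)
qed

lemma log_weight_ineq_6: "2 * log_weight y 2 + log_weight y 3 + log_weight y 5 + log_weight y 8 < log_weight y 1 + log_weight y 4"
proof -
  have s: "y^2 < 1" "y^3 < 1" "y^4 < 1" "y^5 < 1" "y^8 < 1" "y < 1"
    using y by (auto simp: power_less_one_iff)
  \<comment> \<open>Here (1 - y) (1 - y^2) is cancelled from the exponentiated claim, which leaves 1
    + y^2 on the smaller side. The bracket is at least 1/32.\<close>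
  have "0 < y * (1 - y - y^2 - y^3 - y^4 - y^5)"
    using y power_bounds(2)[of 2] power_bounds(2)[of 3] power_bounds(2)[of 4] power_bounds(2)[of 5]
    by (intro mult_pos_pos) (simp_all add: power_divide)
  also have "\<dots> = (1 + y) * (1 - y^3 - y^5) - (1 + y^2)" by algebra
  finally have "1 + y^2 < (1 + y) * (1 - y^3 - y^5)" by simp
  also have "1 - y^3 - y^5 \<le> (1 - y^3) * (1 - y^5) * (1 - y^8)"
  proof -
    have "0 \<le> y^8 * (y^3 + y^5 * (1 - y^3))" using s y by simp
    also have "\<dots> = (1 - y^3) * (1 - y^5) * (1 - y^8) - (1 - y^3 - y^5)" by algebra
    finally show ?thesis by simp
  qed
  finally have "(1 - y) * (1 - y^2) * (1 + y^2)
      < (1 - y) * (1 - y^2) * ((1 + y) * ((1 - y^3) * (1 - y^5) * (1 - y^8)))"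
    using s y by simp
  moreover have "(1 - y) * (1 - y^2) * (1 + y^2) = (1 - y) * (1 - y^4)" by algebra
  moreover have "(1 - y) * (1 - y^2) * ((1 + y) * ((1 - y^3) * (1 - y^5) * (1 - y^8)))
      = (1 - y^2)^2 * (1 - y^3) * (1 - y^5) * (1 - y^8)" by algebra
  ultimately have "(1 - y) * (1 - y^4) < (1 - y^2)^2 * (1 - y^3) * (1 - y^5) * (1 - y^8)"
    by simp
  then have "ln ((1 - y) * (1 - y^4)) < ln ((1 - y^2)^2 * (1 - y^3) * (1 - y^5) * (1 - y^8))"
    using s by (subst ln_less_cancel_iff) auto
  then show ?thesis using s by (simp add: log_weight_def ln_mult ln_realpow)
qed

text \<open>Let q = \<open>core m\<close>. If q \<ge> 2, the index q + 1 is no multiple of q and is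
  skipped, so the sum for m exceeds L q - L (q+1) > L (q+1) \<ge> L (\<open>core n\<close>), which
  bounds the sum for n. For q = 1 the index 2 need not be skipped, and the first few coefficients
  are examined instead.\<close>

lemma core_sum_less_of_core_less:
  assumes "m > 0" "n > 0" "core m < core n"
  shows "core_sum n y < core_sum m y"
proof -
  \<comment> \<open>A common upper limit for both sums, large enough to split off the terms up to
    index 8.\<close>
  define N where "N = max (max m n) 9"
  have N: "m \<le> N" "n \<le> N" "N \<ge> 9" by (auto simp: N_def)
  have m: "core m \<ge> 1" using core_pos[OF assms(1)] by simp
  have n: "core_sum n y \<le> log_weight y (core n)" using core_sum_le_log_weight_core assms by simp
  have pos: "log_weight y k > 0" if "k > 0" for k using y that by (simp add: log_weight_pos)
  have half: "2 * log_weight y 2 < log_weight y 1" "2 * log_weight y 3 < log_weight y 2" "2 * log_weight y 4 < log_weight y 3" "2 * log_weight y 5 < log_weight y 4"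
    using log_weight_half[OF y, of 1] log_weight_half[OF y, of 2] log_weight_half[OF y, of 3] log_weight_half[OF y, of 4]
    by (simp_all add: eval_nat_numeral)
  show ?thesis
  proof (cases "core m = 1")
    case False
    let ?q = "core m"
    have "\<bar>\<Sum>j=Suc ?q..N. core_coeff m j * log_weight y j\<bar> < log_weight y (Suc ?q)"
    proof -
      have q: "?q \<ge> 2" using m False by simp
      then have z: "core_coeff m (Suc ?q) = 0"
        by (intro core_coeff_eq_0) (metis Suc_eq_plus1 dvd_add_right_iff dvd_refl nat_dvd_1_iff_1 False)
      have "core n \<le> N" using N(2) by (simp add: core_def) (meson div_le_dividend le_trans)
      then have "Suc ?q \<le> N" using assms(3) by simp
      then have "(\<Sum>j=Suc ?q..N. core_coeff m j * log_weight y j) = (\<Sum>j=Suc (Suc ?q)..N. core_coeff m j * log_weight y j)"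
        by (simp add: sum.atLeast_Suc_atMost z)
      then show ?thesis using log_weight_tail[of "Suc ?q" m N] by simp
    qed
    moreover have "log_weight y (core n) \<le> log_weight y (Suc ?q)"
      using assms(3) by (intro log_weight_antimono) auto
    ultimately show ?thesis
      using n core_sum_core[OF assms(1) N(1)] log_weight_half[OF y, of ?q] m by linarith
  next
    case True
    have k: "core_coeff m j = (if j dvd m then moebius j else 0)" for j
      using True by (simp add: core_coeff_def)
    have pr: "prime (3::nat)" "prime (5::nat)" by auto
    have k1: "core_coeff m 1 = 1" "core_coeff m 4 = 0" by (simp_all add: k moebius_4)
    have k2: "core_coeff m 2 = (if 2 dvd m then -1 else 0)"
         "core_coeff m 3 = (if 3 dvd m then -1 else 0)" "core_coeff m 5 \<ge> -1"
      using abs_core_coeff_le[of m 5] by (simp_all add: k moebius_prime pr)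
    have split4: "core_sum m y = log_weight y 1 + core_coeff m 2 * log_weight y 2 + core_coeff m 3 * log_weight y 3
        + (\<Sum>j=Suc 4..N. core_coeff m j * log_weight y j)"
      unfolding core_sum_from_1[OF assms(1) N(1)]
      using N k1 by (simp add: sum.atLeast_Suc_atMost eval_nat_numeral)
    note tail4 = log_weight_tail[of 4 m N]
    \<comment> \<open>Since the coefficient of m at 4 vanishes, its sum exceeds L 1 - L 2 - L 3 - L
      4, where L 2 or L 3 drops out if 2 or 3 does not divide m. This is compared with the upper
      bound L (\<open>core n\<close>); only the last case requires more.\<close>
    consider "core n \<ge> 4" | "core n = 3" | "core n = 2" "odd m"
      | "core n = 2" "even m" "\<not> 3 dvd m" | "core n = 2" "even m" "3 dvd m"
      using assms(3) True by linarith
    then show ?thesis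
    proof cases
      case 1
      then have "log_weight y (core n) \<le> log_weight y 4" by (intro log_weight_antimono) auto
      then show ?thesis using n split4 tail4 half k2 pos[of 2] pos[of 3]
        by (simp split: if_splits)
    next
      case 2
      then show ?thesis using n split4 tail4 log_weight_ineq_3 k2 pos[of 2] pos[of 3]
        by (simp split: if_splits)
    next
      case 3
      then show ?thesis using n split4 tail4 half k2 pos[of 2] pos[of 3]
        by (simp split: if_splits)
    next
      case 4
      then show ?thesis using n split4 tail4 half log_weight_ineq_2 k2 pos[of 2] pos[of 3]
        by (simp split: if_splits)
    next
      case 5
      \<comment> \<open>Now L 1 - L 2 - L 3 can fall below L 2, for instance at y = 1/2, so both
        bounds are refined: the coefficient 1 at index 6 absorbs the tail of m beyond 6, and n gains
        a negative term at index 4.\<close>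
      have "6 dvd m" using 5 divides_mult[of 2 m 3] by simp
      then have k6: "core_coeff m 6 = 1" by (simp add: k moebius_6)
      have m': "core_sum m y > log_weight y 1 - log_weight y 2 - log_weight y 3 - log_weight y 5"
      proof -
        have "core_sum m y = log_weight y 1 - log_weight y 2 - log_weight y 3 + core_coeff m 5 * log_weight y 5 + log_weight y 6
            + (\<Sum>j=Suc 6..N. core_coeff m j * log_weight y j)"
          unfolding core_sum_from_1[OF assms(1) N(1)]
          using N k1 k2 k6 5 by (simp add: sum.atLeast_Suc_atMost eval_nat_numeral)
        moreover have "core_coeff m 5 * log_weight y 5 \<ge> - log_weight y 5"
          using mult_right_mono[OF k2(3), of "log_weight y 5"] pos[of 5] by simp
        ultimately show ?thesis using log_weight_tail[of 6 m N] by linarith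
      qed
      have n': "core_sum n y < log_weight y 2 - log_weight y 4 + log_weight y 8"
      proof -
        \<comment> \<open>Core 2 makes n, hence also its radical, even, so 4 divides n. Odd indices
          drop out, and so does 8 because \<open>moebius 4 = 0\<close>.\<close>
        have c2: "2 * radical n = n" using core_radical[OF assms(2)] 5 by simp
        have "even (radical n)"
          using prime_dvd_radical_iff[of 2 n] assms(2) c2 by (metis dvd_triv_left two_is_prime_nat)
        then have "4 dvd n" using c2 by (metis mult_dvd_mono dvd_refl numeral_Bit0 mult_2)
        then have "core_coeff n 4 = -1" using 5 by (simp add: core_coeff_def moebius_prime)
        moreover have "core_coeff n 6 \<le> 0" using 5 by (simp add: core_coeff_def moebius_prime pr)
        moreover have "core_coeff n 8 = 0" using 5 by (simp add: core_coeff_def moebius_4)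
        moreover have "core_coeff n 1 = 0" "core_coeff n 3 = 0" "core_coeff n 5 = 0" "core_coeff n 7 = 0"
          using 5 by (simp_all add: core_coeff_def)
        moreover have "core_coeff n 2 = 1" using core_coeff_core[OF assms(2)] 5 by simp
        ultimately have "core_sum n y = log_weight y 2 - log_weight y 4 + core_coeff n 6 * log_weight y 6
            + (\<Sum>j=Suc 8..N. core_coeff n j * log_weight y j)"
          unfolding core_sum_from_1[OF assms(2) N(2)]
          using N by (simp add: sum.atLeast_Suc_atMost eval_nat_numeral)
        moreover have "core_coeff n 6 * log_weight y 6 \<le> 0"
          using \<open>core_coeff n 6 \<le> 0\<close> pos[of 6] by (simp add: mult_nonpos_nonneg)
        ultimately show ?thesis using log_weight_tail[of 8 n N] by linarith
      qed
      show ?thesis using m' n' log_weight_ineq_6 by linarith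
    qed
  qed
qed

text \<open>For equal cores, the two coefficients at j are each either 0 or the same Moebius value,
  so their difference again lies in {-1, 0, 1}. It is nonzero at n, which does not divide the
  smaller m.\<close>

lemma core_sum_inj_of_core_eq:
  assumes "m > 0" "n > 0" "m < n" "core m = core n"
  shows "core_sum n y \<noteq> core_sum m y"
proof -
  let ?c = "\<lambda>j. core_coeff n j - core_coeff m j"
  have "?c j \<in> {-1, 0, 1}" for j
    using moebius_cases[of "j div core n"] assms by (auto simp: core_coeff_def)
  moreover have "?c n \<noteq> 0"
    using core_coeff_self[OF assms(2)] assms by (auto simp: core_coeff_def dest: dvd_imp_le)
  ultimately have "(\<Sum>j=1..n. ?c j * log_weight y j) \<noteq> 0"
    using y assms by (intro halving_signed_sum_neq_0[where i = n] log_weight_pos log_weight_half) auto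
  then show ?thesis
    using assms by (simp add: core_sum_from_1[of _ n] left_diff_distrib sum_subtractf)
qed

lemma core_sum_inj:
  assumes "m > 0" "n > 0" "core_sum m y = core_sum n y"
  shows "m = n"
  using assms core_sum_less_of_core_less core_sum_inj_of_core_eq
  by (metis less_irrefl linorder_neqE_nat)

end

section \<open>Cyclotomic polynomials at real arguments\<close>

text \<open>X^n - 1 has only simple roots: its derivative can vanish only at 0, which is not a
  root.\<close>

lemma prod_diff_roots_of_unity:
  fixes X :: complex
  assumes "n > 0"
  shows "(\<Prod>z | z ^ n = 1. X - z) = X ^ n - 1"
proof -
  let ?p = "monom 1 n - 1 :: complex poly"
  have root: "poly ?p z = 0 \<longleftrightarrow> z ^ n = 1" for z by (simp add: poly_monom)
  have "rsquarefree ?p"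
    unfolding rsquarefree_roots
  proof (intro allI notI)
    fix a assume a: "poly ?p a = 0 \<and> poly (pderiv ?p) a = 0"
    then have "of_nat n * a ^ (n - 1) = 0" by (simp add: pderiv_diff pderiv_monom poly_monom)
    then have "a = 0" using assms by simp
    with a assms show False by (simp add: poly_monom power_0_left)
  qed
  from complex_poly_decompose_rsquarefree[OF this]
  have "poly (smult (lead_coeff ?p) (\<Prod>z|poly ?p z = 0. [:-z, 1:])) X = poly ?p X" by simp
  moreover have "lead_coeff ?p = 1"
  proof -
    have "degree (monom 1 n - 1 :: complex poly) = n"
      using degree_add_eq_left[of "-1 :: complex poly" "monom 1 n"] assms
      by (simp add: degree_monom_eq)
    then show ?thesis using assms by simp
  qed
  ultimately show ?thesis unfolding root by (simp add: poly_prod poly_monom)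
qed

lemma poly_cyclotomic:
  "poly (cyclotomic n) X = (\<Prod>a\<in>totatives n. X - cis (2 * pi * (real a / real n)))"
proof -
  have "{a. 1 \<le> a \<and> a \<le> n \<and> coprime a n} = totatives n"
    by (auto simp: totatives_def)
  then show ?thesis
    by (simp add: cyclotomic_def poly_prod Complex.DeMoivre mult_ac)
qed

text \<open>The n-th roots of unity, indexed by k in 1..n, are sorted by d = \<open>gcd k n\<close>;
  writing k = d * j turns the class of d into the primitive roots of order
  \<open>n div d\<close>.\<close>

lemma prod_cyclotomic:
  fixes X :: complex
  assumes "n > 0"
  shows "(\<Prod>d | d dvd n. poly (cyclotomic d) X) = X ^ n - 1"
proof -
  let ?f = "\<lambda>k. X - cis (2 * pi * (real k / real n))"
  have fin: "finite {d. d dvd n}" using assms by simp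
  have "(\<Prod>d | d dvd n. poly (cyclotomic d) X) = (\<Prod>d | d dvd n. poly (cyclotomic (n div d)) X)"
    using assms
    by (intro prod.reindex_bij_witness[of _ "\<lambda>d. n div d" "\<lambda>d. n div d"])
       (auto simp: div_div_eq_right)
  also have "\<dots> = (\<Prod>d | d dvd n. \<Prod>k | k \<in> {0<..n} \<and> gcd k n = d. ?f k)"
  proof (intro prod.cong refl)
    fix d assume "d \<in> {d. d dvd n}"
    then have d: "d dvd n" by simp
    then have "d > 0" using assms by (auto intro: Nat.gr0I)
    then have "real k / real (n div d) = real (k * d) / real n" for k
      using d assms by (simp add: real_of_nat_div)
    then have "poly (cyclotomic (n div d)) X = (\<Prod>k\<in>totatives (n div d). ?f (k * d))"
      unfolding poly_cyclotomic by (intro prod.cong) auto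
    also have "\<dots> = (\<Prod>k | k \<in> {0<..n} \<and> gcd k n = d. ?f k)"
      by (rule prod.reindex_bij_betw[OF bij_betw_totatives_gcd_eq[OF d assms], of ?f])
    finally show "poly (cyclotomic (n div d)) X = (\<Prod>k | k \<in> {0<..n} \<and> gcd k n = d. ?f k)" .
  qed
  also have "\<dots> = (\<Prod>k\<in>{0<..n}. ?f k)"
    using prod.group[of "{0<..n}" "{d. d dvd n}" "\<lambda>k. gcd k n" ?f] fin by auto
  \<comment> \<open>The enumeration of the roots used below runs over k < n, so the factor at k = n
    is exchanged for the equal factor at k = 0.\<close>
  also have "{0<..n} = insert n {0<..<n}" using assms by auto
  also have "(\<Prod>k\<in>\<dots>. ?f k) = (\<Prod>k\<in>insert 0 {0<..<n}. ?f k)"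
    using assms by simp
  also have "insert 0 {0<..<n} = {..<n}" using assms by auto
  also have "(\<Prod>k<n. ?f k) = (\<Prod>k<n. X - cis (2 * pi * real k / real n))" by simp
  also have "\<dots> = (\<Prod>z | z ^ n = 1. X - z)"
    by (rule prod.reindex_bij_betw[OF Complex.bij_betw_roots_unity[OF assms], of "\<lambda>z. X - z"])
  finally show ?thesis using prod_diff_roots_of_unity[OF assms] by simp
qed

text \<open>By induction the factors at proper divisors agree, and being nonzero they cancel. This
  identifies cyclotomic values from their divisor products alone.\<close>

lemma divisor_prod_unique:
  fixes f g :: "nat \<Rightarrow> 'a :: field"
  assumes eq: "\<And>n. n > 0 \<Longrightarrow> (\<Prod>d | d dvd n. f d) = (\<Prod>d | d dvd n. g d)"
    and nz: "\<And>n. n > 0 \<Longrightarrow> g n \<noteq> 0"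
    and "n > 0"
  shows "f n = g n"
  using \<open>n > 0\<close>
proof (induction n rule: less_induct)
  case (less n)
  have D: "{d. d dvd n} = insert n {d. d dvd n \<and> d \<noteq> n}" and fin: "finite {d. d dvd n \<and> d \<noteq> n}"
    using less.prems by auto
  have pos: "d > 0" if "d dvd n" for d using that less.prems by (auto intro: Nat.gr0I)
  have "(\<Prod>d | d dvd n \<and> d \<noteq> n. f d) = (\<Prod>d | d dvd n \<and> d \<noteq> n. g d)"
    using less pos by (intro prod.cong) (auto simp: dvd_imp_le order.not_eq_order_implies_strict)
  moreover have "(\<Prod>d | d dvd n \<and> d \<noteq> n. g d) \<noteq> 0"
    using nz pos fin by auto
  moreover have "f n * (\<Prod>d | d dvd n \<and> d \<noteq> n. f d) = g n * (\<Prod>d | d dvd n \<and> d \<noteq> n. g d)"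
    using eq[OF less.prems] fin unfolding D by simp
  ultimately show ?case by simp
qed

section \<open>Moebius products for the values of cyclotomic polynomials\<close>

definition psi :: "nat \<Rightarrow> real \<Rightarrow> real" where
  "psi n y = exp (\<Sum>d | d dvd n. moebius (n div d) * ln (1 - y ^ d))"

lemma psi_pos: "psi n y > 0"
  by (simp add: psi_def)

text \<open>All factors 1 - y^d with d > 0 are positive here, so logarithms are legitimate and
  \<open>moebius_inversion\<close> applies to ln (1 - y^d).\<close>

lemma prod_psi:
  assumes "\<bar>y\<bar> < 1" "n > 0"
  shows "(\<Prod>d | d dvd n. psi d y) = 1 - y ^ n"
proof -
  have "\<bar>y ^ n\<bar> < 1" using assms by (simp add: power_abs power_less_one_iff)
  then have "1 - y ^ n > 0" by linarith
  moreover have "(\<Prod>d | d dvd n. psi d y) = exp (ln (1 - y ^ n))"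
    using assms moebius_inversion[of n "\<lambda>d. ln (1 - y ^ d)"]
    by (simp add: psi_def exp_sum[symmetric])
  ultimately show ?thesis by simp
qed

lemma psi_eq_exp_core_sum:
  assumes "n > 0"
  shows "psi n y = exp (- moebius (radical n) * core_sum n y)"
proof -
  have "(\<Sum>d | d dvd n. moebius (n div d) * ln (1 - y ^ d))
      = (\<Sum>d | d dvd n. - moebius (radical n) * (core_coeff n d * log_weight y d))"
    using moebius_cofactor[OF assms] by (intro sum.cong) (auto simp: log_weight_def)
  then show ?thesis by (simp add: psi_def core_sum_def sum_distrib_left)
qed

lemma poly_cyclotomic_abs_less_1:
  assumes "\<bar>x\<bar> < 1" "n > 0"
  shows "poly (cyclotomic n) (of_real x) = of_real ((if n = 1 then -1 else 1) * psi n x)"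
  using _ _ assms(2)
proof (rule divisor_prod_unique)
  fix n :: nat assume n: "n > 0"
  \<comment> \<open>The divisor 1 occurs exactly once for every n, so its sign turns 1 - x^n into
    x^n - 1.\<close>
  have "(\<Prod>d | d dvd n. (if d = 1 then -1 else 1) * psi d x) = - (1 - x ^ n)"
    using n by (simp only: prod.distrib prod_psi[OF assms(1) n]) (simp add: prod.delta)
  then show "(\<Prod>d | d dvd n. poly (cyclotomic d) (of_real x)) =
      (\<Prod>d | d dvd n. of_real ((if d = 1 then -1 else 1) * psi d x))"
    unfolding prod_cyclotomic[OF n] by (simp only: of_real_prod[symmetric]) simp
  show "complex_of_real ((if n = 1 then -1 else 1) * psi n x) \<noteq> 0"
    using psi_pos[of n x] by simp
qed

definition cyc_value :: "real \<Rightarrow> nat \<Rightarrow> real" where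
  "cyc_value x n = x ^ totient n * psi n (1 / x)"

text \<open>The totients of the divisors of n add up to n, which collects the powers of x into
  x^n.\<close>

lemma prod_cyc_value:
  assumes "\<bar>x\<bar> > 1" "n > 0"
  shows "(\<Prod>d | d dvd n. cyc_value x d) = x ^ n - 1"
proof -
  have x: "x \<noteq> 0" "\<bar>1 / x\<bar> < 1" using assms by auto
  have "(\<Prod>d | d dvd n. cyc_value x d) = x ^ n * (1 - (1 / x) ^ n)"
    by (simp only: cyc_value_def prod.distrib prod_psi[OF x(2) assms(2)] power_sum[symmetric]
        totient_divisor_sum)
  also have "\<dots> = x ^ n - 1" using x by (simp add: power_one_over right_diff_distrib)
  finally show ?thesis .
qed

lemma poly_cyclotomic_abs_gt_1:
  assumes "\<bar>x\<bar> > 1" "n > 0"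
  shows "poly (cyclotomic n) (of_real x) = of_real (cyc_value x n)"
  using _ _ assms(2)
proof (rule divisor_prod_unique)
  fix n :: nat assume n: "n > 0"
  show "(\<Prod>d | d dvd n. poly (cyclotomic d) (of_real x)) = (\<Prod>d | d dvd n. of_real (cyc_value x d))"
    unfolding prod_cyclotomic[OF n]
    by (simp only: of_real_prod[symmetric] prod_cyc_value[OF assms(1) n]) simp
  show "complex_of_real (cyc_value x n) \<noteq> 0"
    using psi_pos[of n "1 / x"] assms by (auto simp: cyc_value_def)
qed

text \<open>The logarithm of \<open>psi\<close> is a sign times a positive core sum. Equality
  therefore forces equal signs and equal core sums.\<close>

lemma psi_inj:
  assumes "0 < y" "y \<le> 1/2" "m > 0" "n > 0" "psi m y = psi n y"
  shows "m = n"
proof -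
  have eq: "moebius (radical m) * core_sum m y = moebius (radical n) * core_sum n y"
    using assms by (simp add: psi_eq_exp_core_sum)
  have pos: "core_sum m y > 0" "core_sum n y > 0" using assms by (simp_all add: core_sum_pos)
  have "core_sum m y = core_sum n y"
    using eq pos moebius_squarefree[OF squarefree_radical[of m]]
      moebius_squarefree[OF squarefree_radical[of n]] by auto
  then show ?thesis using core_sum_inj[of y m n] assms by simp
qed

section \<open>The substitution of -y for y\<close>

lemma psi_double:
  assumes "odd n" "\<bar>y\<bar> < 1"
  shows "psi (2 * n) y = psi n (- y)"
proof -
  have n: "n > 0" using assms by (auto intro: Nat.gr0I)
  let ?D = "{d. d dvd n}"
  have fin: "finite ?D" using n by simp
  have odd: "odd d" if "d dvd n" for d using that assms by (meson dvd_trans)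
  have dis: "?D \<inter> (*) 2 ` ?D = {}" using odd by fastforce
  have D: "{d. d dvd 2 * n} = ?D \<union> (*) 2 ` ?D"
  proof (intro equalityI subsetI)
    fix d assume "d \<in> {d. d dvd 2 * n}"
    then have d: "d dvd 2 * n" by simp
    show "d \<in> ?D \<union> (*) 2 ` ?D"
    proof (cases "even d")
      case True
      then obtain e where "d = 2 * e" by blast
      with d show ?thesis by auto
    next
      case False
      then have "coprime d 2" by simp
      then have "d dvd n" using d by (simp add: coprime_dvd_mult_right_iff)
      then show ?thesis by simp
    qed
  qed auto
  \<comment> \<open>The divisors d and 2 * d are paired. Their Moebius factors are opposite because
    \<open>n div d\<close> is odd, and the quotient of 1 - y^(2d) by 1 - y^d is 1 + y^d = 1 - (-y)^d
    for odd d.\<close>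
  have "(\<Sum>d | d dvd 2 * n. moebius (2 * n div d) * ln (1 - y ^ d))
      = (\<Sum>d\<in>?D. moebius (2 * n div d) * ln (1 - y ^ d))
        + (\<Sum>d\<in>?D. moebius (n div d) * ln (1 - y ^ (2 * d)))"
    unfolding D using fin dis by (simp add: sum.union_disjoint sum.reindex inj_on_def)
  also have "\<dots> = (\<Sum>d\<in>?D. moebius (n div d) * ln (1 - (- y) ^ d))"
    unfolding sum.distrib[symmetric]
  proof (intro sum.cong refl)
    fix d assume d: "d \<in> ?D"
    then obtain e where e: "n = d * e" by auto
    then have d0: "d > 0" using n by simp
    have "odd e" using e assms by auto
    then have "moebius (2 * e) = - moebius e"
      by (simp add: moebius_mult_coprime moebius_prime)
    then have m: "moebius (2 * n div d) = - moebius (n div d)"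
      using e d0 by (simp add: mult.left_commute[of 2])
    have yd: "\<bar>y ^ d\<bar> < 1" using assms d0 by (simp add: power_abs power_less_one_iff)
    then have "1 - y ^ d > 0" "1 + y ^ d > 0" by linarith+
    moreover have "1 - y ^ (2 * d) = (1 - y ^ d) * (1 + y ^ d)"
      by (simp add: algebra_simps power_mult power2_eq_square mult_2 power_add)
    ultimately have "ln (1 - y ^ (2 * d)) = ln (1 - y ^ d) + ln (1 + y ^ d)"
      by (simp add: ln_mult)
    moreover have "(- y) ^ d = - (y ^ d)" using odd d by simp
    ultimately show "moebius (2 * n div d) * ln (1 - y ^ d) + moebius (n div d) * ln (1 - y ^ (2 * d))
        = moebius (n div d) * ln (1 - (- y) ^ d)"
      unfolding m by (simp add: algebra_simps)
  qed
  finally show ?thesis by (simp add: psi_def)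
qed

text \<open>For odd d the cofactor is divisible by 4 and its Moebius value is 0; for even d the
  power does not see the sign.\<close>

lemma psi_minus_4_dvd:
  assumes "4 dvd n" "n > 0"
  shows "psi n (- y) = psi n y"
proof -
  have "moebius (n div d) * ln (1 - (- y) ^ d) = moebius (n div d) * ln (1 - y ^ d)"
    if "d dvd n" for d
  proof (cases "even d")
    case False
    from that obtain e where e: "n = d * e" by blast
    then have d0: "d > 0" using assms by simp
    have "coprime 4 d" using False coprime_power_left_iff[of 2 2 d] by simp
    then have "4 dvd e" using assms e by (simp add: coprime_dvd_mult_right_iff)
    then have "\<not> squarefree e" by (intro not_squarefreeI[of 2]) auto
    then show ?thesis using e d0 by (simp add: moebius_not_squarefree)
  qed simp
  then show ?thesis unfolding psi_def by (intro arg_cong[where f = exp] sum.cong) auto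
qed

text \<open>The index for which \<open>psi (neg_index n) y = psi n (- y)\<close>.\<close>
definition neg_index :: "nat \<Rightarrow> nat" where
  "neg_index n = (if odd n then 2 * n else if 4 dvd n then n else n div 2)"

lemma neg_index_pos: "n > 0 \<Longrightarrow> neg_index n > 0"
  by (auto simp: neg_index_def elim!: evenE)

text \<open>An involution is injective, which carries uniqueness of the index from -x back to
  x.\<close>

lemma neg_index_neg_index: "neg_index (neg_index n) = n"
proof -
  consider "odd n" | "4 dvd n" | "even n" "\<not> 4 dvd n" by blast
  then show ?thesis
  proof cases
    case 1
    then have "\<not> 4 dvd 2 * n" by presburger
    with 1 show ?thesis by (simp add: neg_index_def)
  next
    case 2
    then have "even n" by presburger
    with 2 show ?thesis by (simp add: neg_index_def)
  next
    case 3
    then have "odd (n div 2)" by presburger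
    with 3 show ?thesis by (simp add: neg_index_def)
  qed
qed

lemma psi_minus:
  assumes "\<bar>y\<bar> < 1" "n > 0"
  shows "psi n (- y) = psi (neg_index n) y"
proof -
  have "odd n \<or> 4 dvd n \<or> n = 2 * (n div 2) \<and> odd (n div 2)" by presburger
  then consider "odd n" | "4 dvd n" | k where "n = 2 * k" "odd k" by blast
  then show ?thesis
  proof cases
    case 1
    then show ?thesis using psi_double[of n y] assms by (simp add: neg_index_def)
  next
    case 2
    then show ?thesis using psi_minus_4_dvd assms by (auto simp: neg_index_def)
  next
    case 3
    then have "\<not> 4 dvd n" by auto
    then show ?thesis using 3 psi_double[of k "- y"] assms by (simp add: neg_index_def)
  qed
qed

lemma totient_neg_index: "totient (neg_index n) = totient n"
proof (cases "odd n \<or> 4 dvd n")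
  case False
  then have "even n" "\<not> 4 dvd n" by auto
  then obtain k where k: "n = 2 * k" by blast
  then have "odd k" using \<open>\<not> 4 dvd n\<close> by (auto elim!: evenE)
  with False k show ?thesis using totient_double[of k] by (simp add: neg_index_def)
qed (use totient_double[of n] in \<open>auto simp: neg_index_def\<close>)

section \<open>Comparison of values\<close>

text \<open>The exponent of \<open>psi\<close> is plus or minus a core sum bounded by L 1, and exp
  (L 1) = 1 / (1 - y). The lower bound excludes n = 1, where it is attained.\<close>

lemma psi_bounds:
  assumes "0 < y" "y \<le> 1/2" "n > 0"
  shows "n > 1 \<Longrightarrow> 1 - y < psi n y" "psi n y \<le> 1 / (1 - y)"
proof -
  have F: "0 < core_sum n y" "core_sum n y \<le> log_weight y 1" "n > 1 \<Longrightarrow> core_sum n y < log_weight y 1"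
    using assms core_sum_pos core_sum_less_log_weight_1 core_sum_le_log_weight_core[of y n] core_pos[of n]
      log_weight_antimono[of y 1 "core n"] by auto
  have e: "exp (- log_weight y 1) = 1 - y" "exp (log_weight y 1) = 1 / (1 - y)"
    using assms by (simp_all add: log_weight_def exp_minus divide_simps)
  have s: "moebius (radical n) = 1 \<or> moebius (radical n) = -1"
    by (intro moebius_squarefree squarefree_radical)
  show "1 - y < psi n y" if "n > 1"
    unfolding e(1)[symmetric] psi_eq_exp_core_sum[OF assms(3)] using F s that by auto
  show "psi n y \<le> 1 / (1 - y)"
    unfolding e(2)[symmetric] psi_eq_exp_core_sum[OF assms(3)] using F s by auto
qed

text \<open>For n \<ge> 7 there is a totative besides 1 and n - 1: it is 2 if n is odd, n/2 - 1 if
  n/2 is even, and n/2 - 2 if n/2 is odd.\<close>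

lemma totient_eq_2:
  assumes "totient n = 2"
  shows "n \<in> {3, 4, 6}"
proof (rule ccontr)
  assume n: "n \<notin> {3, 4, 6}"
  have t: "totient 0 = 0" "totient 1 = 1" "totient 2 = 1" "totient 5 = 4"
    using totient_prime[of 5] by simp_all
  have "n \<notin> {0, 1, 2, 5}"
  proof
    assume "n \<in> {0, 1, 2, 5}"
    then show False using t assms by (elim insertE) simp_all
  qed
  with n have n7: "n \<ge> 7" by auto
  obtain a where a: "a \<in> totatives n" "a \<noteq> 1" "a \<noteq> n - 1"
  proof -
    consider "odd n" | k where "n = 2 * k" "even k" | k where "n = 2 * k" "odd k"
      by (metis evenE)
    then show ?thesis
    proof cases
      case 1
      then show ?thesis using n7 by (intro that[of 2]) (auto simp: in_totatives_iff)
    next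
      case 2
      have "coprime (k - 1) (2 * k)"
        using 2 n7 coprime_diff_one_left_nat[of k] by (auto simp: coprime_mult_right_iff)
      then show ?thesis using 2 n7 by (intro that[of "k - 1"]) (auto simp: in_totatives_iff)
    next
      case 3
      have "coprime (k - 2) (2 * k)"
      proof -
        have "coprime (k - 2) k"
        proof (rule coprimeI)
          fix d assume d: "d dvd k - 2" "d dvd k"
          have "k - (k - 2) = 2" using n7 3(1) by linarith
          then have "d dvd 2" using dvd_diff_nat[OF d(2) d(1)] by argo
          moreover have "odd d" using d 3 dvd_trans by blast
          ultimately show "is_unit d" using prime_nat_iff[of 2] two_is_prime_nat by auto
        qed
        moreover have "odd (k - 2)" using 3 n7 by simp
        ultimately show ?thesis by (simp add: coprime_mult_right_iff)
      qed
      then show ?thesis using 3 n7 by (intro that[of "k - 2"]) (auto simp: in_totatives_iff)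
    qed
  qed
  have "card {1, n - 1, a} \<le> card (totatives n)"
    using a n7 minus_one_in_totatives[of n] by (intro card_mono) auto
  then show False using a n7 assms by (simp add: totient_def)
qed

lemma divisors_small:
  "{d. d dvd 1} = {1::nat}" "{d. d dvd 2} = {1, 2::nat}" "{d. d dvd 3} = {1, 3::nat}"
  "{d. d dvd 4} = {1, 2, 4::nat}" "{d. d dvd 6} = {1, 2, 3, 6::nat}"
proof -
  have le: "{d. d dvd n} = {d. d \<le> n \<and> d dvd n}" if "n > 0" for n :: nat
    using that by (auto dest: dvd_imp_le)
  have "d \<le> 6 \<longleftrightarrow> d = 0 \<or> d = 1 \<or> d = 2 \<or> d = 3 \<or> d = 4 \<or> d = 5 \<or> d = 6" for d :: nat by linarith
  then show "{d. d dvd 6} = {1, 2, 3, 6::nat}" by (subst le) (auto simp del: One_nat_def)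
  have "d \<le> 4 \<longleftrightarrow> d = 0 \<or> d = 1 \<or> d = 2 \<or> d = 3 \<or> d = 4" for d :: nat by linarith
  then show "{d. d dvd 4} = {1, 2, 4::nat}" by (subst le) (auto simp del: One_nat_def)
  have "d \<le> 3 \<longleftrightarrow> d = 0 \<or> d = 1 \<or> d = 2 \<or> d = 3" for d :: nat by linarith
  then show "{d. d dvd 3} = {1, 3::nat}" by (subst le) (auto simp del: One_nat_def)
  have "d \<le> 2 \<longleftrightarrow> d = 0 \<or> d = 1 \<or> d = 2" for d :: nat by linarith
  then show "{d. d dvd 2} = {1, 2::nat}" by (subst le) (auto simp del: One_nat_def)
qed auto

section \<open>Comparison of values at x \<ge> 2\<close>

context
  fixes x :: real
  assumes x: "x \<ge> 2"
begin

lemma cyc_value_small: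
  "cyc_value x 1 = x - 1" "cyc_value x 2 = x + 1" "cyc_value x 3 = x^2 + x + 1"
  "cyc_value x 4 = x^2 + 1" "cyc_value x 6 = x^2 - x + 1"
proof -
  have P: "n > 0 \<Longrightarrow> (\<Prod>d | d dvd n. cyc_value x d) = x ^ n - 1" for n
    using prod_cyc_value x by simp
  show 1: "cyc_value x 1 = x - 1" using P[of 1] by (simp add: divisors_small)
  have "(x - 1) * cyc_value x 2 = x ^ 2 - 1"
    using P[of 2] unfolding divisors_small by (simp flip: 1)
  also have "\<dots> = (x - 1) * (x + 1)" by algebra
  finally show 2: "cyc_value x 2 = x + 1" using x by simp
  have "(x - 1) * cyc_value x 3 = x ^ 3 - 1"
    using P[of 3] unfolding divisors_small by (simp flip: 1)
  also have "\<dots> = (x - 1) * (x^2 + x + 1)" by algebra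
  finally show 3: "cyc_value x 3 = x^2 + x + 1" using x by simp
  have "(x - 1) * (x + 1) * cyc_value x 4 = x ^ 4 - 1"
    using P[of 4] unfolding divisors_small by (simp flip: 1 2 add: mult.assoc)
  also have "\<dots> = (x - 1) * (x + 1) * (x^2 + 1)" by algebra
  finally show "cyc_value x 4 = x^2 + 1" using x by simp
  have nz: "(x - 1) * (x + 1) * (x^2 + x + 1) \<noteq> 0"
    using x by (simp add: add_pos_pos less_imp_neq[symmetric])
  have "(x - 1) * (x + 1) * (x^2 + x + 1) * cyc_value x 6 = x ^ 6 - 1"
    using P[of 6] unfolding divisors_small by (simp flip: 1 2 3 add: mult.assoc)
  also have "\<dots> = (x - 1) * (x + 1) * (x^2 + x + 1) * (x^2 - x + 1)" by algebra
  finally show "cyc_value x 6 = x^2 - x + 1" using nz by (simp only: mult_cancel_left) simp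
qed

lemma cyc_value_pos: "cyc_value x n > 0"
  using x psi_pos by (simp add: cyc_value_def)

text \<open>A gap of at least 2 between the totients beats the fluctuation of \<open>psi\<close>. A
  gap of 1 forces totients 1 and 2 by parity, leaving finitely many explicit polynomials.\<close>

lemma cyc_value_less:
  assumes "m > 0" "totient m < totient n" "\<not> (x = 2 \<and> m = 2 \<and> n = 6)"
  shows "cyc_value x m < cyc_value x n"
proof -
  have n2: "n > 2"
  proof (rule ccontr)
    assume "\<not> n > 2"
    then have "n = 0 \<or> n = 1 \<or> n = 2" by auto
    then have "totient n \<le> 1" by auto
    moreover have "totient m > 0" using assms(1) by simp
    ultimately show False using assms(2) by linarith
  qed
  show ?thesis
  proof (cases "totient m + 2 \<le> totient n")
    case True
    define y where "y = 1 / x"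
    have y: "0 < y" "y \<le> 1/2" using x by (auto simp: y_def field_simps)
    \<comment> \<open>With y = 1/x this says that the factor x^2 covers the whole ratio between the
      two bounds 1 / (1 - y) and 1 - y for \<open>psi\<close>.\<close>
    have "1 \<le> (x - 1)^2" using x by (simp add: one_le_power)
    also have "\<dots> = x^2 * (1 - y)^2" using x by (simp add: y_def field_simps power2_eq_square)
    finally have *: "1 / (1 - y) \<le> x^2 * (1 - y)" using y
      by (simp add: field_simps power2_eq_square)
    have "cyc_value x m \<le> x ^ totient m * (1 / (1 - y))"
      unfolding cyc_value_def y_def[symmetric]
      using psi_bounds(2)[OF y assms(1)] x by (intro mult_left_mono) auto
    also have "\<dots> \<le> x ^ totient m * (x^2 * (1 - y))"
      using * x by (intro mult_left_mono) auto
    also have "\<dots> = x ^ (totient m + 2) * (1 - y)" by (simp add: power_add power2_eq_square)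
    also have "\<dots> \<le> x ^ totient n * (1 - y)"
      using True x y by (intro mult_right_mono power_increasing) auto
    also have "\<dots> < cyc_value x n"
      unfolding cyc_value_def y_def[symmetric]
      using psi_bounds(1)[OF y, of n] x n2 by (intro mult_strict_left_mono) auto
    finally show ?thesis .
  next
    case False
    have "even (totient n)" using n2 by (rule totient_even)
    moreover have eq: "totient n = Suc (totient m)" using False assms(2) by simp
    ultimately have "odd (totient m)" by simp
    then have m: "m = 1 \<or> m = 2" using totient_even[of m] assms(1) by linarith
    then have "totient n = 2" using eq by auto
    then have n: "n = 3 \<or> n = 4 \<or> n = 6" using totient_eq_2 by blast
    have "x * 2 \<le> x * x" using x by (intro mult_left_mono) auto
    then have le: "2 * x \<le> x^2" by (simp add: power2_eq_square)
    have V: "x + 1 < cyc_value x 3" "x + 1 < cyc_value x 4" "x - 1 < cyc_value x 6"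
      using le x by (simp_all add: cyc_value_small)
    show ?thesis
    proof (cases "m = 2 \<and> n = 6")
      case True
      \<comment> \<open>The inequality x + 1 < x^2 - x + 1 amounts to 2 x < x^2 and becomes an
        equality at x = 2: this is the exceptional case.\<close>
      then have "x > 2" using assms(3) x by linarith
      then have "2 * x < x^2" by (simp add: power2_eq_square)
      then show ?thesis using True by (simp add: cyc_value_small)
    next
      case False
      have V12: "cyc_value x 1 = x - 1" "cyc_value x 2 = x + 1" by (fact cyc_value_small)+
      have "cyc_value x m \<le> x + 1" using m V12 by (elim disjE) simp_all
      moreover have "cyc_value x m = x - 1" if "n = 6" using m V12 False that by (elim disjE) simp_all
      ultimately show ?thesis using n V by (elim disjE) simp_all
    qed
  qed
qed

lemma cyc_value_inj:
  assumes "m > 0" "n > 0" "cyc_value x m = cyc_value x n" "\<not> (x = 2 \<and> {m, n} = {2, 6})"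
  shows "m = n"
proof -
  have "totient m = totient n"
  proof (cases "totient m" "totient n" rule: linorder_cases)
    case less
    then show ?thesis using cyc_value_less[of m n] assms by auto
  next
    case greater
    then show ?thesis using cyc_value_less[of n m] assms by auto
  qed
  then have "psi m (1 / x) = psi n (1 / x)"
    using assms(3) x by (simp add: cyc_value_def)
  then show ?thesis using psi_inj[of "1 / x" m n] x assms by (simp add: field_simps)
qed

end

section \<open>Return to real arguments of either sign\<close>

lemma cyc_value_minus:
  assumes "x > 1" "n > 0"
  shows "cyc_value (- x) n = (-1) ^ totient n * cyc_value x (neg_index n)"
proof -
  have "psi n (1 / - x) = psi (neg_index n) (1 / x)"
    using psi_minus[of "1 / x" n] assms by simp
  moreover have "(- x) ^ totient n = (-1) ^ totient n * x ^ totient n"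
    by (rule power_minus)
  ultimately show ?thesis by (simp add: cyc_value_def totient_neg_index)
qed

lemma poly_cyclotomic_inj_le_half:
  assumes "x \<noteq> 0" "\<bar>x\<bar> \<le> 1/2" "m > 0" "n > 0"
    and "poly (cyclotomic m) (complex_of_real x) = poly (cyclotomic n) (complex_of_real x)"
  shows "m = n"
proof -
  have "(if m = 1 then -1 else 1) * psi m x = (if n = 1 then -1 else 1) * psi n x"
    using assms(5) poly_cyclotomic_abs_less_1[of x] assms(2-4) by (simp del: of_real_mult)
  \<comment> \<open>Positivity of \<open>psi\<close> rules out opposite signs in the preceding
    equation.\<close>
  then have eq: "psi m x = psi n x"
    using psi_pos[of m x] psi_pos[of n x] by (auto split: if_splits)
  show ?thesis
  proof (cases "x > 0")
    case True
    then show ?thesis using psi_inj eq assms by simp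
  next
    case False
    then have "psi (neg_index m) (- x) = psi (neg_index n) (- x)"
      using eq psi_minus[of "- x" m] psi_minus[of "- x" n] assms by simp
    then have "neg_index m = neg_index n"
      using False assms by (intro psi_inj[of "- x"] neg_index_pos) auto
    then show ?thesis by (metis neg_index_neg_index)
  qed
qed

lemma poly_cyclotomic_inj_ge_2:
  assumes "\<bar>x\<bar> \<ge> 2" "m > 0" "n > 0" "\<not> (x = 2 \<and> {m, n} = {2, 6})"
    and "poly (cyclotomic m) (complex_of_real x) = poly (cyclotomic n) (complex_of_real x)"
  shows "m = n"
proof -
  have eq: "cyc_value x m = cyc_value x n"
    using assms(5) poly_cyclotomic_abs_gt_1[of x] assms(1-3) by simp
  show ?thesis
  proof (cases "x > 0")
    case True
    then show ?thesis using cyc_value_inj[of x m n] eq assms by simp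
  next
    case False
    let ?V = "\<lambda>k. cyc_value (- x) (neg_index k)"
    have x: "- x \<ge> 2" using False assms by simp
    have eq': "(-1) ^ totient m * ?V m = (-1) ^ totient n * ?V n"
      using eq cyc_value_minus[of "- x" m] cyc_value_minus[of "- x" n] x assms by simp
    have pos: "?V m > 0" "?V n > 0" using cyc_value_pos[OF x] by simp_all
    have par: "even (totient m) = even (totient n)" and V: "?V m = ?V n"
      using eq' pos by (auto simp: minus_one_power_iff split: if_splits)
    \<comment> \<open>No exception arises for negative x: the indices 2 and 6 have totients 1 and 2,
      which would give the two values opposite signs.\<close>
    have "{neg_index m, neg_index n} \<noteq> {2, 6}"
    proof
      assume "{neg_index m, neg_index n} = {2, 6}"
      then have "neg_index m = 2 \<and> neg_index n = 6 \<or> neg_index m = 6 \<and> neg_index n = 2"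
        by (auto simp: doubleton_eq_iff)
      then have "totient m = 1 \<and> totient n = 2 \<or> totient m = 2 \<and> totient n = 1"
        using totient_neg_index[of m] totient_neg_index[of n] by auto
      with par show False by auto
    qed
    then have "neg_index m = neg_index n"
      using cyc_value_inj[OF x, of "neg_index m" "neg_index n"] V neg_index_pos assms by auto
    then show ?thesis by (metis neg_index_neg_index)
  qed
qed

theorem theorem1p1:
  shows "(\<forall>(m::nat) (n::nat) (x::real).
            m > 0 \<longrightarrow> n > 0 \<longrightarrow> m \<noteq> n \<longrightarrow> x \<noteq> 0 \<longrightarrow>
            poly (cyclotomic m) (complex_of_real x) = poly (cyclotomic n) (complex_of_real x) \<longrightarrow>
            \<not> (x = 2 \<and> {m, n} = {2, 6}) \<longrightarrow>
            1 / 2 < \<bar>x\<bar> \<and> \<bar>x\<bar> < 2)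
         \<and> poly (cyclotomic 2) 2 = poly (cyclotomic 6) 2"
proof (intro conjI allI impI)
  fix m n :: nat and x :: real
  assume *: "m > 0" "n > 0" "m \<noteq> n" "x \<noteq> 0"
    "poly (cyclotomic m) (complex_of_real x) = poly (cyclotomic n) (complex_of_real x)"
    "\<not> (x = 2 \<and> {m, n} = {2, 6})"
  show "1 / 2 < \<bar>x\<bar>" using poly_cyclotomic_inj_le_half[of x m n] * by linarith
  show "\<bar>x\<bar> < 2" using poly_cyclotomic_inj_ge_2[of x m n] * by linarith
next
  show "poly (cyclotomic 2) 2 = poly (cyclotomic 6) 2"
    using poly_cyclotomic_abs_gt_1[of 2 2] poly_cyclotomic_abs_gt_1[of 2 6]
    by (simp add: cyc_value_small)
qed

end
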